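(* Let $D$ be a two-dimensional compact disc and let $\phi\colon\mathbb{R}\times D\to D$ be a continuous flow. If $\phi$ is kinematic expansive, then $\phi$ has a singularity in the interior of $D$.
   Context: A singularity of $\phi$ is a point $p$ with $\phi_t(p)=p$ for all $t\in\mathbb{R}$. A continuous flow $\phi$ on a compact metric space is kinematic expansive if for all $\epsilon>0$ there exists $\delta>0$ such that if $\operatorname{dist}(\phi_t(x),\phi_t(y))<\delta$ for all $t\in\mathbb{R}$ then there exists $s\in\mathbb{R}$ with $|s|<\epsilon$ and $y=\phi_s(x)$. *)

theory Defs
  imports "HOL-Analysis.Analysis"
begin

text \<open>
  Flows live on a subset \<open>X\<close> of a metric space, with the induced metric; the values of
  \<open>\<phi>\<close> outside \<open>X\<close> are irrelevant.
\<close>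

definition continuous_flow_on :: "'a::metric_space set \<Rightarrow> (real \<Rightarrow> 'a \<Rightarrow> 'a) \<Rightarrow> bool" where
  "continuous_flow_on X \<phi> \<longleftrightarrow>
     continuous_on (UNIV \<times> X) (\<lambda>(t, x). \<phi> t x) \<and>
     (\<forall>t. \<forall>x\<in>X. \<phi> t x \<in> X) \<and>
     (\<forall>x\<in>X. \<phi> 0 x = x) \<and>
     (\<forall>s t. \<forall>x\<in>X. \<phi> (s + t) x = \<phi> s (\<phi> t x))"

definition kinematic_expansive_on :: "'a::metric_space set \<Rightarrow> (real \<Rightarrow> 'a \<Rightarrow> 'a) \<Rightarrow> bool" where
  "kinematic_expansive_on X \<phi> \<longleftrightarrow>
     (\<forall>\<epsilon>>0. \<exists>\<delta>>0. \<forall>x\<in>X. \<forall>y\<in>X.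
        (\<forall>t. dist (\<phi> t x) (\<phi> t y) < \<delta>) \<longrightarrow> (\<exists>s. \<bar>s\<bar> < \<epsilon> \<and> y = \<phi> s x))"

definition singularity :: "(real \<Rightarrow> 'a \<Rightarrow> 'a) \<Rightarrow> 'a \<Rightarrow> bool" where
  "singularity \<phi> p \<longleftrightarrow> (\<forall>t. \<phi> t p = p)"

definition compact_disc :: "'a::metric_space set \<Rightarrow> bool" where
  "compact_disc D \<longleftrightarrow> D homeomorphic (cball 0 1 :: (real^2) set)"

text \<open>
  The interior in the sense of surfaces with boundary: the points with a relatively open
  neighbourhood homeomorphic to an open disc.  It is intrinsic to \<open>D\<close>, unlike the
  topological interior of \<open>D\<close> as a subset of its ambient space.
\<close>

definition surface_interior :: "'a::metric_space set \<Rightarrow> 'a set" where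
  "surface_interior D =
     {p \<in> D. \<exists>U. openin (top_of_set D) U \<and> p \<in> U \<and> U homeomorphic (ball 0 1 :: (real^2) set)}"

end

theory Submission imports Defs
begin

text \<open>
  Conjugate the flow to the closed unit disc of the complex plane and suppose that it has no
  singularity in the interior.

  Every \<open>\<omega>\<close>-limit point is then a singularity. Otherwise an orbit returns to a local section,
  and closing it up gives a simple closed curve \<open>G\<close> along which \<open>\<phi> s z - z\<close> is, for small \<open>s\<close>,
  homotopic through secant maps to the antipodal secant \<open>G (\<theta> + T/2) - G \<theta>\<close>, which has odd
  degree. So \<open>\<phi> s\<close> has a fixed point on or inside \<open>G\<close> for all small \<open>s\<close>, and these accumulate
  at a singularity inside \<open>G\<close>.

  Expansiveness makes the singularities finite in number, so every orbit converges to a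
  singularity in both time directions. By Baire's theorem there is an open set of points whose
  orbits, outside one common bounded time interval, all stay near the same two singularities.
  Nearby points of this set are never separated by the flow, so by expansiveness a small ball lies
  in a single orbit arc, which is absurd.
\<close>

section \<open>Continuous logarithms along closed curves\<close>

text \<open>Logarithms of one number differ by multiples of 2 pi i, so \<open>d\<close> has discrete
  range, and continuity on a connected set leaves it no room to jump.\<close>

lemma continuous_exp_constant_imp_constant:
  fixes d :: "'a::topological_space \<Rightarrow> complex"
  assumes "connected S" "continuous_on S d" and "\<And>x. x \<in> S \<Longrightarrow> exp (d x) = c"
  shows "d constant_on S"
proof (rule continuous_discrete_range_constant[OF assms(1,2)])
  fix x assume x: "x \<in> S"
  have "2*pi \<le> norm (d y - d x)" if y: "y \<in> S" "d y \<noteq> d x" for y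
  proof (rule ccontr)
    assume "\<not> ?thesis"
    then have "\<bar>Im (d y) - Im (d x)\<bar> < 2*pi"
      using abs_Im_le_cmod[of "d y - d x"] by simp
    then show False
      using y x assms(3) exp_complex_eqI by metis
  qed
  then show "\<exists>e>0. \<forall>y. y \<in> S \<and> d y \<noteq> d x \<longrightarrow> e \<le> norm (d y - d x)"
    by (intro exI[of _ "2*pi"]) auto
qed

text \<open>A logarithm with equal ends means winding number 0 about the origin; this is its
  homotopy invariance. The contractible rectangle carries a logarithm \<open>J\<close> of all of
  \<open>H\<close>. It differs from \<open>l\<close> by a constant on the side \<open>h = 0\<close>,
  and the end gap \<open>J (T, h) - J (0, h)\<close> has exponential 1, so it does not depend on
  \<open>h\<close>.\<close>

lemma periodic_log_homotopy:
  fixes H :: "real \<times> real \<Rightarrow> complex"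
  assumes T: "0 \<le> T" and H: "continuous_on ({0..T} \<times> {0..1}) H"
    and nz: "\<And>\<theta> h. \<theta> \<in> {0..T} \<Longrightarrow> h \<in> {0..1} \<Longrightarrow> H (\<theta>, h) \<noteq> 0"
    and per: "\<And>h. h \<in> {0..1} \<Longrightarrow> H (T, h) = H (0, h)"
    and l: "continuous_on {0..T} l" "\<And>\<theta>. \<theta> \<in> {0..T} \<Longrightarrow> H (\<theta>, 0) = exp (l \<theta>)" "l T = l 0"
  obtains l' where "continuous_on {0..T} l'" "\<And>\<theta>. \<theta> \<in> {0..T} \<Longrightarrow> H (\<theta>, 1) = exp (l' \<theta>)" "l' T = l' 0"
proof -
  have "contractible ({0..T} \<times> {0..1::real})"
    using convex_imp_contractible convex_Times by blast
  then obtain J where J: "continuous_on ({0..T} \<times> {0..1}) J"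
      "\<And>x. x \<in> {0..T} \<times> {0..1} \<Longrightarrow> H x = exp (J x)"
    using continuous_logarithm_on_contractible[OF H] nz by (metis mem_Times_iff prod.collapse)
  have "(\<lambda>\<theta>. J (\<theta>, 0) - l \<theta>) constant_on {0..T}"
  proof (rule continuous_exp_constant_imp_constant)
    show "continuous_on {0..T} (\<lambda>\<theta>. J (\<theta>, 0) - l \<theta>)"
      by (intro continuous_intros l continuous_on_compose2[OF J(1)]) auto
    show "exp (J (\<theta>, 0) - l \<theta>) = 1" if "\<theta> \<in> {0..T}" for \<theta>
      using that J(2)[of "(\<theta>, 0)"] l(2)[of \<theta>] by (simp add: exp_diff)
  qed auto
  then obtain k where "\<And>\<theta>. \<theta> \<in> {0..T} \<Longrightarrow> J (\<theta>, 0) - l \<theta> = k"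
    by (auto simp: constant_on_def)
  from this[of 0] this[of T] have J0: "J (T, 0) = J (0, 0)"
    using l(3) T by (simp add: algebra_simps)
  have "(\<lambda>h. J (T, h) - J (0, h)) constant_on {0..1}"
  proof (rule continuous_exp_constant_imp_constant)
    show "continuous_on {0..1} (\<lambda>h. J (T, h) - J (0, h))"
      using T by (intro continuous_intros continuous_on_compose2[OF J(1)]) auto
    show "exp (J (T, h) - J (0, h)) = 1" if "h \<in> {0..1}" for h
      using that T J(2)[of "(T, h)"] J(2)[of "(0, h)"] per[OF that] by (simp add: exp_diff)
  qed auto
  then obtain k where "\<And>h. h \<in> {0..1} \<Longrightarrow> J (T, h) - J (0, h) = k"
    by (auto simp: constant_on_def)
  from this[of 0] this[of 1] have "J (T, 1) = J (0, 1)"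
    using J0 by simp
  moreover have "continuous_on {0..T} (\<lambda>\<theta>. J (\<theta>, 1))"
    by (intro continuous_intros continuous_on_compose2[OF J(1)]) auto
  ultimately show ?thesis
    using J(2) by (intro that[of "\<lambda>\<theta>. J (\<theta>, 1)"]) auto
qed

text \<open>An antiperiodic closed curve has odd winding number. Each half turn changes the
  logarithm by the same \<open>k\<close> with \<open>exp k = -1\<close>; equal ends would force
  \<open>2 * k = 0\<close>.\<close>

lemma antiperiodic_log_not_periodic:
  fixes g l :: "real \<Rightarrow> complex"
  assumes T: "0 \<le> T" and anti: "\<And>\<theta>. \<theta> \<in> {0..T/2} \<Longrightarrow> g (\<theta> + T/2) = - g \<theta>"
    and l: "continuous_on {0..T} l" "\<And>\<theta>. \<theta> \<in> {0..T} \<Longrightarrow> g \<theta> = exp (l \<theta>)"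
  shows "l T \<noteq> l 0"
proof
  assume eq: "l T = l 0"
  let ?d = "\<lambda>\<theta>. l (\<theta> + T/2) - l \<theta>"
  have exp: "exp (?d \<theta>) = -1" if "\<theta> \<in> {0..T/2}" for \<theta>
  proof -
    have "exp (l (\<theta> + T/2)) = - exp (l \<theta>)"
      using that anti[OF that] l(2)[of \<theta>] l(2)[of "\<theta> + T/2"] by auto
    then show ?thesis by (simp add: exp_diff)
  qed
  have "?d constant_on {0..T/2}"
  proof (rule continuous_exp_constant_imp_constant[OF _ _ exp])
    show "continuous_on {0..T/2} ?d"
      using T by (intro continuous_intros continuous_on_compose2[OF l(1)]) auto
  qed auto
  then obtain k where k: "\<And>\<theta>. \<theta> \<in> {0..T/2} \<Longrightarrow> ?d \<theta> = k"
    by (auto simp: constant_on_def)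
  have "2 * k = ?d 0 + ?d (T/2)"
    using k[of 0] k[of "T/2"] T by simp
  also have "\<dots> = 0" using eq by simp
  finally have "k = 0" by simp
  then show False using exp[of 0] k[of 0] T by simp
qed

text \<open>Filling in \<open>S\<close> leaves only its outside as complement, which is connected in
  the plane. A compact plane set with connected complement is Borsukian, so nonvanishing functions
  on it have logarithms.\<close>

lemma continuous_log_on_filled:
  fixes f :: "complex \<Rightarrow> complex"
  assumes "compact S" "continuous_on (S \<union> inside S) f" "\<And>z. z \<in> S \<union> inside S \<Longrightarrow> f z \<noteq> 0"
  obtains l where "continuous_on (S \<union> inside S) l" "\<And>z. z \<in> S \<union> inside S \<Longrightarrow> f z = exp (l z)"
proof -
  have "bounded S" using assms(1) compact_imp_bounded by blast
  have "closed (S \<union> inside S)"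
    unfolding union_with_inside using assms(1) by (intro closed_Compl open_outside compact_imp_closed)
  then have "compact (S \<union> inside S)"
    using \<open>bounded S\<close> by (simp add: compact_eq_bounded_closed bounded_inside)
  moreover have "connected (- (S \<union> inside S))"
    using \<open>bounded S\<close> unfolding outside_inside[symmetric] by (intro connected_outside) auto
  ultimately have "Borsukian (S \<union> inside S)"
    using Borsukian_separation_compact by blast
  then show ?thesis
    using assms(2,3) that unfolding Borsukian_continuous_logarithm by blast
qed

section \<open>Flows\<close>

locale flow_on =
  fixes X :: "'a::metric_space set" and \<phi> :: "real \<Rightarrow> 'a \<Rightarrow> 'a"
  assumes flow: "continuous_flow_on X \<phi>"
begin

lemma flow_in [simp, intro]: "x \<in> X \<Longrightarrow> \<phi> t x \<in> X"
  and flow_0 [simp]: "x \<in> X \<Longrightarrow> \<phi> 0 x = x"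
  and flow_add: "x \<in> X \<Longrightarrow> \<phi> (s + t) x = \<phi> s (\<phi> t x)"
  using flow by (auto simp: continuous_flow_on_def)

lemma flow_flow [simp]: "x \<in> X \<Longrightarrow> \<phi> s (\<phi> t x) = \<phi> (s + t) x"
  by (simp add: flow_add)

lemma continuous_on_flow [continuous_intros]:
  assumes "continuous_on S f" "continuous_on S g" "\<And>u. u \<in> S \<Longrightarrow> g u \<in> X"
  shows "continuous_on S (\<lambda>u. \<phi> (f u) (g u))"
proof -
  have "continuous_on (UNIV \<times> X) (\<lambda>(t, x). \<phi> t x)"
    using flow by (simp add: continuous_flow_on_def)
  then have "continuous_on S (\<lambda>u. (\<lambda>(t, x). \<phi> t x) (f u, g u))"
    by (rule continuous_on_compose2) (use assms in \<open>auto intro!: continuous_intros\<close>)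
  then show ?thesis by simp
qed

lemma flow_of_int_period:
  assumes "x \<in> X" "\<phi> s x = x"
  shows "\<phi> (of_int k * s) x = x"
proof -
  have nat: "\<phi> (of_nat n * s) x = x" for n
  proof (induction n)
    case (Suc n)
    have "\<phi> (of_nat (Suc n) * s) x = \<phi> s (\<phi> (of_nat n * s) x)"
      using assms by (simp add: algebra_simps)
    then show ?case using Suc assms by simp
  qed (use assms in simp)
  have "\<phi> (- (of_nat n * s)) x = x" for n
    using flow_add[OF assms(1), of "- (of_nat n * s)" "of_nat n * s"] nat[of n] assms(1) by simp
  with nat show ?thesis
    by (cases k rule: int_cases2) auto
qed

text \<open>The largest multiple \<open>k n\<close> of the period \<open>s n\<close> not exceeding
  \<open>t\<close> fixes \<open>p n\<close> and tends to \<open>t\<close>; joint continuity then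
  gives \<open>\<phi> t q = lim p n = q\<close>.\<close>

lemma limit_of_small_periods_singular:
  assumes p: "\<And>n::nat. p n \<in> X" "p \<longlonglongrightarrow> q" "q \<in> X"
    and s: "\<And>n. 0 < s n" "s \<longlonglongrightarrow> 0" and per: "\<And>n. \<phi> (s n) (p n) = p n"
  shows "singularity \<phi> q"
  unfolding singularity_def
proof
  fix t
  define k where "k n = of_int \<lfloor>t / s n\<rfloor> * s n" for n
  have k: "t - s n \<le> k n" "k n \<le> t" for n
  proof -
    have "of_int \<lfloor>t / s n\<rfloor> \<le> t / s n" "t / s n \<le> of_int \<lfloor>t / s n\<rfloor> + 1"
      by linarith+
    then have "of_int \<lfloor>t / s n\<rfloor> * s n \<le> t" "t \<le> (of_int \<lfloor>t / s n\<rfloor> + 1) * s n"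
      using s(1)[of n] by (simp_all only: pos_le_divide_eq pos_divide_le_eq)
    then show "t - s n \<le> k n" "k n \<le> t"
      by (simp_all add: k_def algebra_simps)
  qed
  have "k \<longlonglongrightarrow> t"
  proof (rule tendsto_sandwich)
    show "(\<lambda>n. t - s n) \<longlonglongrightarrow> t" using tendsto_diff[OF tendsto_const s(2), of t] by simp
  qed (use k in auto)
  then have lim: "(\<lambda>n. (k n, p n)) \<longlonglongrightarrow> (t, q)"
    using p by (intro tendsto_intros)
  have cont: "continuous_on (UNIV \<times> X) (\<lambda>(t, x). \<phi> t x)"
    using flow by (simp add: continuous_flow_on_def)
  have "(\<lambda>n. \<phi> (k n) (p n)) \<longlonglongrightarrow> \<phi> t q"
    using continuous_on_tendsto_compose[OF cont lim] p by simp
  moreover have "\<phi> (k n) (p n) = p n" for n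
    unfolding k_def using flow_of_int_period[OF p(1) per] .
  ultimately have "p \<longlonglongrightarrow> \<phi> t q" by simp
  then show "\<phi> t q = q" using p(2) LIMSEQ_unique by blast
qed

end

section \<open>Returning orbits force an interior singularity\<close>

text \<open>Convexity keeps filled curves and short segments inside \<open>X\<close>, and makes
  \<open>X\<close> the closure of its interior when that is nonempty.\<close>

locale planar_flow = flow_on X \<phi> for X :: "complex set" and \<phi> +
  assumes compact_X: "compact X" and convex_X: "convex X"
begin

text \<open>
  An orbit arc \<open>y \<rightarrow> \<phi> T y\<close> is closed up along a path \<open>c\<close> that the flow leaves
  instantly: in its last stretch the curve \<open>G\<close> drifts across \<open>c\<close> while still moving forward
  in time.
\<close>

lemma singularity_of_closed_up_orbit:
  assumes T: "0 < T" and \<epsilon>: "0 < \<epsilon>"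
    and c: "continuous_on {0..1::real} c" "c ` {0..1} \<subseteq> X" "c 0 = \<phi> T (c 1)"
    and free: "\<And>h u. 0 < h \<Longrightarrow> h \<le> \<epsilon> \<Longrightarrow> u \<in> {0..1} \<Longrightarrow> \<phi> h (c u) \<notin> c ` {0..1}"
    and nohit: "\<And>r. 0 < r \<Longrightarrow> r < T \<Longrightarrow> \<phi> r (c 1) \<notin> c ` {0..1}"
  shows "\<exists>p\<in>interior X. singularity \<phi> p"
proof -
  \<comment> \<open>Since \<open>\<epsilon> < T\<close> (shown below), halving gives
    \<open>T/2 < T - e\<close>, so that the lags up to \<open>T/2\<close> stay where
    \<open>G\<close> is known to be periodic.\<close>
  define e where "e = \<epsilon> / 2"
  \<comment> \<open>The foot point \<open>C\<close> rests at \<open>c 0\<close> until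
    \<open>T - e\<close>, runs along \<open>c\<close> during the last stretch and rests at
    \<open>c 1\<close> from \<open>T\<close> on. So \<open>G\<close> is the orbit arc of
    \<open>c 1\<close> up to \<open>T - e\<close> and is back at \<open>c 1\<close> at time
    \<open>T\<close>.\<close>
  define C where "C \<theta> = c (max 0 (min 1 ((\<theta> - T + e) / e)))" for \<theta>
  define G where "G \<theta> = \<phi> (\<theta> - T) (C \<theta>)" for \<theta>
  have e: "0 < e" "2 * e = \<epsilon>" using \<epsilon> by (auto simp: e_def)
  have c01: "c 0 \<in> c ` {0..1}" "c 1 \<in> c ` {0..1}" by auto
  then have cX: "c 0 \<in> X" "c 1 \<in> X" using c(2) by blast+
  \<comment> \<open>\<open>c 1\<close> reaches \<open>c 0\<close> at time \<open>T\<close>, which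
    \<open>free\<close> excludes for times up to \<open>\<epsilon>\<close>.\<close>
  have "\<not> T \<le> \<epsilon>"
    using free[of T 1] T c(3) c01 by auto
  with e have eT: "2 * e < T" by simp
  have C_in: "C \<theta> \<in> c ` {0..1}" for \<theta>
    unfolding C_def by auto
  then have C_X: "C \<theta> \<in> X" for \<theta>
    using c(2) by blast
  have C0: "C \<theta> = c 0" if "\<theta> \<le> T - e" for \<theta>
  proof -
    have "(\<theta> - T + e) / e \<le> 0" using that e(1) by (simp add: divide_le_0_iff)
    then show ?thesis by (simp add: C_def max_def min_def)
  qed
  have C1: "C \<theta> = c 1" if "T \<le> \<theta>" for \<theta>
  proof -
    have "1 \<le> (\<theta> - T + e) / e" using that e(1) by simp
    then show ?thesis by (simp add: C_def max_def min_def)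
  qed
  have contC: "continuous_on UNIV C"
    unfolding C_def using e(1)
    by (intro continuous_on_compose2[OF c(1)] continuous_intros) auto
  have contG: "continuous_on U (\<lambda>x. G (f x))" if "continuous_on U f" for U :: "'b::topological_space set" and f
    unfolding G_def using C_X that
    by (intro continuous_intros continuous_on_compose2[OF contC]) auto
  have G_X: "G \<theta> \<in> X" for \<theta>
    using C_X by (simp add: G_def)
  have per: "G (\<theta> + T) = G \<theta>" if "0 \<le> \<theta>" "\<theta> \<le> T - e" for \<theta>
    using that C0[of \<theta>] C1[of "\<theta> + T"] c(3) cX by (simp add: G_def)
  \<comment> \<open>Flowing by \<open>T - \<theta>\<close> turns a coincidence on \<open>G\<close>
    into a passage from \<open>c\<close> to \<open>c\<close> in time
    \<open>\<sigma> + \<kappa>\<close>, the situation of \<open>free\<close> and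
    \<open>nohit\<close>.\<close>
  have shift: "\<phi> (\<sigma> + \<kappa>) (C (\<theta> + \<kappa>)) = C \<theta>" if "\<phi> \<sigma> (G (\<theta> + \<kappa>)) = G \<theta>" for \<sigma> \<kappa> \<theta>
    using arg_cong[OF that, of "\<phi> (T - \<theta>)"] C_X by (simp add: G_def algebra_simps)
  have push: "\<phi> \<sigma> (G (\<theta> + \<kappa>)) \<noteq> G \<theta>" if "0 < \<sigma> + \<kappa>" "\<sigma> + \<kappa> \<le> \<epsilon>" for \<sigma> \<kappa> \<theta>
    using shift free[OF that] C_in by (metis imageE)
  have inj: "G (\<theta> + \<kappa>) \<noteq> G \<theta>" if \<kappa>: "0 < \<kappa>" "\<kappa> < T" for \<theta> \<kappa>
  proof
    assume "G (\<theta> + \<kappa>) = G \<theta>"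
    then have eq: "\<phi> \<kappa> (C (\<theta> + \<kappa>)) = C \<theta>"
      using shift[of 0] G_X by simp
    \<comment> \<open>In the first three cases the orbit of \<open>c 1\<close> meets
      \<open>c\<close> at time \<open>\<kappa>\<close> or \<open>T - \<kappa>\<close>, against
      \<open>nohit\<close>. In the last, both parameters lie in the drifting stretch, so
      \<open>\<kappa> < e\<close> and \<open>free\<close> applies.\<close>
    consider "T \<le> \<theta> + \<kappa>" | "\<theta> + \<kappa> \<le> T - e" | "\<theta> \<le> T - e" | "T - e < \<theta>" "\<theta> + \<kappa> < T"
      by linarith
    then show False
    proof cases
      case 1
      then show ?thesis using eq C1 nohit[OF \<kappa>] C_in by metis
    next
      case 2
      then have "\<phi> \<kappa> (\<phi> T (c 1)) = \<phi> T (c 1)"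
        using eq C0[of \<theta>] C0[of "\<theta> + \<kappa>"] \<kappa> c(3) by simp
      then have "\<phi> (-T) (\<phi> \<kappa> (\<phi> T (c 1))) = \<phi> (-T) (\<phi> T (c 1))" by simp
      then have "\<phi> \<kappa> (c 1) = c 1" using cX by simp
      then show ?thesis using nohit[OF \<kappa>] c01 by simp
    next
      case 3
      then have "\<phi> \<kappa> (C (\<theta> + \<kappa>)) = \<phi> T (c 1)" using eq C0 c(3) by simp
      then have "\<phi> (-\<kappa>) (\<phi> \<kappa> (C (\<theta> + \<kappa>))) = \<phi> (-\<kappa>) (\<phi> T (c 1))" by simp
      then have "C (\<theta> + \<kappa>) = \<phi> (T - \<kappa>) (c 1)" using cX C_X by simp
      then show ?thesis using nohit[of "T - \<kappa>"] \<kappa> C_in by (metis diff_gt_0_iff_gt diff_less_eq less_add_same_cancel1)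
    next
      case 4
      then have "\<kappa> \<le> \<epsilon>" using e by linarith
      then show ?thesis using eq free[OF \<kappa>(1)] C_in by (metis imageE)
    qed
  qed
  define S where "S = G ` {0..T}"
  define K where "K = S \<union> inside S"
  have compS: "compact S"
    unfolding S_def by (intro compact_continuous_image contG continuous_intros compact_Icc)
  have SX: "S \<subseteq> X" using G_X by (auto simp: S_def)
  \<comment> \<open>The complement of the convex \<open>X\<close> is all outside, so nothing
    enclosed by \<open>S\<close> leaves \<open>X\<close>.\<close>
  have "outside X \<subseteq> outside S" using SX by (rule outside_mono)
  then have "- X \<subseteq> outside S" using outside_convex[OF convex_X] by simp
  then have KX: "K \<subseteq> X" unfolding K_def union_with_inside by blast
  have GK: "G \<theta> \<in> K" if "0 \<le> \<theta>" "\<theta> \<le> T" for \<theta>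
    using that by (auto simp: K_def S_def)
  have fixed: "\<exists>z\<in>K. \<phi> s z = z" if s: "0 < s" "s \<le> e" for s
  proof (rule ccontr)
    assume nofix: "\<not> ?thesis"
    \<comment> \<open>Without fixed points the displacement has a logarithm on the whole filled
      curve, hence one with equal ends along \<open>G\<close>.\<close>
    obtain l where l: "continuous_on K l" "\<And>z. z \<in> K \<Longrightarrow> \<phi> s z - z = exp (l z)"
    proof (rule continuous_log_on_filled[OF compS])
      show "continuous_on (S \<union> inside S) (\<lambda>z. \<phi> s z - z)"
        using KX unfolding K_def by (intro continuous_intros) auto
      show "\<phi> s z - z \<noteq> 0" if "z \<in> S \<union> inside S" for z
        using nofix that unfolding K_def by auto
    qed (use K_def in blast)
    \<comment> \<open>The homotopy trades flow time for curve parameter, their sum staying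
      \<open>s\<close>; \<open>push\<close> keeps it away from 0.\<close>
    obtain l1 where l1: "continuous_on {0..T} l1" "\<And>\<theta>. \<theta> \<in> {0..T} \<Longrightarrow> G (\<theta> + s) - G \<theta> = exp (l1 \<theta>)" "l1 T = l1 0"
    proof (rule periodic_log_homotopy[where H = "\<lambda>(\<theta>, h). \<phi> (s * (1 - h)) (G (\<theta> + s * h)) - G \<theta>" and T = T and l = "\<lambda>\<theta>. l (G \<theta>)"])
      show "continuous_on ({0..T} \<times> {0..1}) (\<lambda>(\<theta>, h). \<phi> (s * (1 - h)) (G (\<theta> + s * h)) - G \<theta>)"
        unfolding case_prod_beta using G_X by (intro continuous_intros contG) auto
      show "(case (\<theta>, h) of (\<theta>, h) \<Rightarrow> \<phi> (s * (1 - h)) (G (\<theta> + s * h)) - G \<theta>) \<noteq> 0" for \<theta> h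
        using push[of "s * (1 - h)" "s * h" \<theta>] s e by (simp add: algebra_simps)
      show "(case (T, h) of (\<theta>, h) \<Rightarrow> \<phi> (s * (1 - h)) (G (\<theta> + s * h)) - G \<theta>) =
          (case (0, h) of (\<theta>, h) \<Rightarrow> \<phi> (s * (1 - h)) (G (\<theta> + s * h)) - G \<theta>)" if h: "h \<in> {0..1}" for h
      proof -
        have "s * h \<le> s" using s h by (intro mult_left_le) auto
        with s have "s * h \<le> e" by linarith
        then show ?thesis
          using per[of "s * h"] per[of 0] s h e eT by (simp add: add.commute)
      qed
      show "continuous_on {0..T} (\<lambda>\<theta>. l (G \<theta>))"
        using GK by (intro continuous_on_compose2[OF l(1)] contG continuous_intros) auto
    qed (use T l GK G_X per[of 0] e eT in auto)
    \<comment> \<open>Now the lag grows from \<open>s\<close> to \<open>T/2\<close>, and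
      \<open>inj\<close> keeps the secants nonzero. The final secant is antiperiodic, which
      contradicts equal ends.\<close>
    obtain l2 where l2: "continuous_on {0..T} l2" "\<And>\<theta>. \<theta> \<in> {0..T} \<Longrightarrow> G (\<theta> + T/2) - G \<theta> = exp (l2 \<theta>)" "l2 T = l2 0"
    proof (rule periodic_log_homotopy[where H = "\<lambda>(\<theta>, h). G (\<theta> + (s + h * (T/2 - s))) - G \<theta>" and T = T and l = l1])
      have rng: "0 < s + h * (T/2 - s)" "s + h * (T/2 - s) \<le> T/2" if "h \<in> {0..1}" for h
      proof -
        have "0 \<le> h * (T/2 - s)" "h * (T/2 - s) \<le> T/2 - s"
          using that s eT by (intro mult_nonneg_nonneg mult_left_le_one_le; simp)+
        then show "0 < s + h * (T/2 - s)" "s + h * (T/2 - s) \<le> T/2" using s by linarith+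
      qed
      show "continuous_on ({0..T} \<times> {0..1}) (\<lambda>(\<theta>, h). G (\<theta> + (s + h * (T/2 - s))) - G \<theta>)"
        unfolding case_prod_beta by (intro continuous_intros contG)
      show "(case (\<theta>, h) of (\<theta>, h) \<Rightarrow> G (\<theta> + (s + h * (T/2 - s))) - G \<theta>) \<noteq> 0"
        if "h \<in> {0..1}" for \<theta> h
        using inj[of "s + h * (T/2 - s)" \<theta>] rng[OF that] T by simp
      show "(case (T, h) of (\<theta>, h) \<Rightarrow> G (\<theta> + (s + h * (T/2 - s))) - G \<theta>) =
          (case (0, h) of (\<theta>, h) \<Rightarrow> G (\<theta> + (s + h * (T/2 - s))) - G \<theta>)" if h: "h \<in> {0..1}" for h
        using per[of "s + h * (T/2 - s)"] per[of 0] rng[OF h] e eT by (simp add: add.commute)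
    qed (use T l1 in auto)
    have "l2 T \<noteq> l2 0"
    proof (rule antiperiodic_log_not_periodic[OF _ _ l2(1,2)])
      show "G (\<theta> + T/2 + T/2) - G (\<theta> + T/2) = - (G (\<theta> + T/2) - G \<theta>)" if "\<theta> \<in> {0..T/2}" for \<theta>
        using that per[of \<theta>] eT by (simp add: add.assoc)
    qed (use T in auto)
    with l2(3) show False by simp
  qed
  have "compact K"
  proof -
    have "closed K"
      unfolding K_def union_with_inside using compS by (intro closed_Compl open_outside compact_imp_closed)
    then show ?thesis
      using KX compact_X compact_imp_bounded bounded_subset compact_eq_bounded_closed by metis
  qed
  have "\<exists>z\<in>K. \<phi> (e / real (Suc n)) z = z" for n
    using e(1) by (intro fixed) (auto simp: field_simps)
  then obtain z where z: "\<And>n. z n \<in> K" "\<And>n. \<phi> (e / real (Suc n)) (z n) = z n" by metis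
  obtain p r where p: "p \<in> K" "strict_mono r" "(z \<circ> r) \<longlonglongrightarrow> p"
    using \<open>compact K\<close> z(1) unfolding compact_def by metis
  have sing: "singularity \<phi> p"
  proof (rule limit_of_small_periods_singular)
    show "(\<lambda>n. e / real (Suc (r n))) \<longlonglongrightarrow> 0"
      using LIMSEQ_subseq_LIMSEQ[OF LIMSEQ_Suc[OF lim_const_over_n[of e]] p(2)] by (simp add: o_def)
  qed (use p z KX e in auto)
  \<comment> \<open>A singularity on \<open>G\<close> equals its own foot point on \<open>c\<close>,
    which \<open>free\<close> moves off \<open>c\<close>.\<close>
  have "p \<notin> S"
  proof
    assume "p \<in> S"
    then obtain \<theta> where \<theta>: "p = \<phi> (\<theta> - T) (C \<theta>)" by (auto simp: S_def G_def)
    have "C \<theta> = \<phi> (T - \<theta>) p" using C_X by (simp add: \<theta>)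
    then have "\<phi> e (C \<theta>) = C \<theta>" using sing by (simp add: singularity_def)
    then show False using free[of e] e C_in by (metis imageE less_add_same_cancel1 less_le_not_le linorder_not_le mult_2)
  qed
  then have "p \<in> inside S" using p(1) by (simp add: K_def)
  moreover have "inside S \<subseteq> interior X"
    using KX compS by (intro interior_maximal open_inside compact_imp_closed) (auto simp: K_def)
  ultimately show ?thesis using sing by blast
qed

text \<open>The section is a level set of \<open>f\<close>, the integral of the distance to
  \<open>x\<close> along the orbit over a time window \<open>\<tau>\<close> (the Whitney-Bebutov
  construction). Near \<open>x\<close>, \<open>f\<close> strictly increases along orbits, so each
  nearby orbit piece crosses the level of \<open>f x\<close> exactly once, after the time
  \<open>\<sigma> z\<close>.\<close>

lemma local_section:
  assumes x: "x \<in> X" "\<not> singularity \<phi> x"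
  obtains \<epsilon> \<rho> :: real and \<sigma> :: "complex \<Rightarrow> real"
  where "0 < \<epsilon>" "0 < \<rho>" "continuous_on (X \<inter> cball x \<rho>) \<sigma>"
    and "\<And>z. z \<in> X \<inter> cball x \<rho> \<Longrightarrow> \<bar>\<sigma> z\<bar> \<le> \<epsilon>"
    and "\<And>z w h. z \<in> X \<inter> cball x \<rho> \<Longrightarrow> w \<in> X \<inter> cball x \<rho> \<Longrightarrow> 0 < h \<Longrightarrow> h \<le> \<epsilon> \<Longrightarrow>
           \<phi> h (\<phi> (\<sigma> z) z) \<noteq> \<phi> (\<sigma> w) w"
proof -
  obtain \<tau> where \<tau>: "0 < \<tau>" "\<phi> \<tau> x \<noteq> x"
  proof -
    obtain t where t: "\<phi> t x \<noteq> x" using x(2) by (auto simp: singularity_def)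
    have "\<phi> (-t) x \<noteq> x"
    proof
      assume "\<phi> (-t) x = x"
      then have "\<phi> t (\<phi> (-t) x) = \<phi> t x" by simp
      then show False using t x(1) by simp
    qed
    with t x(1) show ?thesis using that[of t] that[of "-t"] by (cases t "0::real" rule: linorder_cases) auto
  qed
  \<comment> \<open>With a third of the displacement, orbits starting near \<open>x\<close> are
    within \<open>m\<close> of \<open>x\<close> around time 0 and at least \<open>2 * m\<close> away
    around time \<open>\<tau>\<close>.\<close>
  define m where "m = dist (\<phi> \<tau> x) x / 3"
  have m: "0 < m" "dist (\<phi> \<tau> x) x = 3 * m" using \<tau>(2) by (auto simp: m_def)
  have near: "\<exists>d>0. \<forall>s z. z \<in> X \<longrightarrow> \<bar>s - s0\<bar> < d \<longrightarrow> dist z x < d \<longrightarrow> dist (\<phi> s z) (\<phi> s0 x) < m" for s0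
  proof -
    have "continuous_on (UNIV \<times> X) (\<lambda>(t, x). \<phi> t x)"
      using flow by (simp add: continuous_flow_on_def)
    then obtain \<delta> where \<delta>: "\<delta> > 0" "\<And>w. w \<in> UNIV \<times> X \<Longrightarrow> dist w (s0, x) < \<delta> \<Longrightarrow>
        dist ((\<lambda>(t, x). \<phi> t x) w) ((\<lambda>(t, x). \<phi> t x) (s0, x)) < m"
      unfolding continuous_on_iff using m(1) x(1) by (metis SigmaI UNIV_I)
    show ?thesis
    proof (intro exI[of _ "\<delta>/2"] conjI allI impI)
      fix s z assume *: "z \<in> X" "\<bar>s - s0\<bar> < \<delta>/2" "dist z x < \<delta>/2"
      have "dist (s, z) (s0, x) \<le> dist s s0 + dist z x"
        unfolding dist_Pair_Pair by (rule sqrt_sum_squares_le_sum) auto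
      also have "\<dots> < \<delta>" using * by (simp add: dist_real_def)
      finally show "dist (\<phi> s z) (\<phi> s0 x) < m"
        using \<delta>(2)[of "(s, z)"] * by simp
    qed (use \<delta> in simp)
  qed
  obtain d1 where d1: "d1 > 0" "\<And>s z. z \<in> X \<Longrightarrow> \<bar>s\<bar> < d1 \<Longrightarrow> dist z x < d1 \<Longrightarrow> dist (\<phi> s z) x < m"
    using near[of 0] x(1) by auto
  obtain d2 where d2: "d2 > 0" "\<And>s z. z \<in> X \<Longrightarrow> \<bar>s - \<tau>\<bar> < d2 \<Longrightarrow> dist z x < d2 \<Longrightarrow> dist (\<phi> s z) (\<phi> \<tau> x) < m"
    using near[of \<tau>] by auto
  define d where "d = min d1 d2"
  have d: "d > 0" "d \<le> d1" "d \<le> d2" using d1(1) d2(1) by (auto simp: d_def)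
  define f where "f z = integral {0..\<tau>} (\<lambda>r. dist (\<phi> r z) x)" for z
  have contf: "continuous_on X f"
  proof -
    have "continuous_on (X \<times> cbox 0 \<tau>) (\<lambda>(z, r). dist (\<phi> r z) x)"
      unfolding case_prod_beta by (intro continuous_intros) auto
    from integral_continuous_on_param[OF this] show ?thesis
      unfolding f_def by simp
  qed
  have mono: "f (\<phi> a z) < f (\<phi> b z)"
    if z: "z \<in> X" "dist z x < d" and ab: "-d < a" "a < b" "b < d" for z a b
  proof -
    let ?u = "\<lambda>r. dist (\<phi> r z) x"
    have int: "?u integrable_on {p..q}" for p q
      using z by (intro integrable_continuous_interval continuous_intros) auto
    have shift: "f (\<phi> h z) = integral {h..\<tau> + h} ?u" for h
    proof -
      have "f (\<phi> h z) = integral {0..\<tau>} (?u \<circ> (\<lambda>r. r + h))"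
        using z by (simp add: f_def o_def)
      also have "\<dots> = integral {0 + h..\<tau> + h} ?u"
        using z by (intro integral_shift continuous_intros) auto
      finally show ?thesis by simp
    qed
    \<comment> \<open>Sliding the window from \<open>a\<close> to \<open>b\<close> drops a piece
      with integrand at most \<open>m\<close> and adds one of equal length with integrand at least
      \<open>2 * m\<close>.\<close>
    have "integral {a..b} ?u + integral {b..\<tau> + b} ?u = integral {a..\<tau> + b} ?u"
      using \<tau> ab int by (intro Henstock_Kurzweil_Integration.integral_combine) auto
    moreover have "integral {a..\<tau> + a} ?u + integral {\<tau> + a..\<tau> + b} ?u = integral {a..\<tau> + b} ?u"
      using \<tau> ab int by (intro Henstock_Kurzweil_Integration.integral_combine) auto
    moreover have "integral {a..b} ?u \<le> integral {a..b} (\<lambda>_. m)"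
    proof (rule integral_le[OF int])
      show "?u r \<le> m" if r: "r \<in> {a..b}" for r
      proof -
        have "\<bar>r\<bar> < d1" "dist z x < d1" using r z ab d by auto
        then show ?thesis using d1(2)[of z r] z by simp
      qed
    qed auto
    moreover have "integral {\<tau> + a..\<tau> + b} (\<lambda>_. 2 * m) \<le> integral {\<tau> + a..\<tau> + b} ?u"
    proof (rule integral_le[OF _ int])
      show "2 * m \<le> ?u r" if r: "r \<in> {\<tau> + a..\<tau> + b}" for r
      proof -
        have "\<bar>r - \<tau>\<bar> < d2" "dist z x < d2" using r z ab d by auto
        then have "dist (\<phi> r z) (\<phi> \<tau> x) < m" using d2(2)[of z r] z by simp
        then show ?thesis
          using m dist_triangle[of "\<phi> \<tau> x" x "\<phi> r z"] by (simp add: dist_commute)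
      qed
    qed auto
    ultimately have "m * (b - a) \<le> f (\<phi> b z) - f (\<phi> a z)"
      using ab by (simp add: shift algebra_simps)
    moreover have "0 < m * (b - a)" using m(1) ab by simp
    ultimately show ?thesis by simp
  qed
  \<comment> \<open>\<open>2 * \<epsilon> < d\<close> keeps \<open>\<sigma> z + h\<close> in the
    range of \<open>mono\<close> for \<open>h \<le> \<epsilon>\<close>.\<close>
  define \<epsilon> where "\<epsilon> = d / 3"
  have \<epsilon>: "0 < \<epsilon>" "2 * \<epsilon> < d" using d(1) by (auto simp: \<epsilon>_def)
  have contfs: "continuous_on X (\<lambda>z. f (\<phi> s z))" for s
    by (intro continuous_on_compose2[OF contf] continuous_intros) auto
  have "f (\<phi> (-\<epsilon>) x) < f x" "f x < f (\<phi> \<epsilon> x)"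
    using mono[of x "-\<epsilon>" 0] mono[of x 0 \<epsilon>] x(1) \<epsilon> d by auto
  then have "\<forall>\<^sub>F z in at x within X. f (\<phi> (-\<epsilon>) z) < f x" "\<forall>\<^sub>F z in at x within X. f x < f (\<phi> \<epsilon> z)"
    using contfs x(1) order_tendstoD unfolding continuous_on_def by blast+
  then obtain \<rho>1 \<rho>2 where \<rho>12: "0 < \<rho>1" "0 < \<rho>2"
      "\<And>z. z \<in> X \<Longrightarrow> z \<noteq> x \<Longrightarrow> dist z x < \<rho>1 \<Longrightarrow> f (\<phi> (-\<epsilon>) z) < f x"
      "\<And>z. z \<in> X \<Longrightarrow> z \<noteq> x \<Longrightarrow> dist z x < \<rho>2 \<Longrightarrow> f x < f (\<phi> \<epsilon> z)"
    unfolding eventually_at by metis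
  define \<rho> where "\<rho> = Min {\<rho>1, \<rho>2, d} / 2"
  have \<rho>: "0 < \<rho>" "\<rho> < \<rho>1" "\<rho> < \<rho>2" "\<rho> < d" using \<rho>12(1,2) d(1) by (auto simp: \<rho>_def min_def)
  let ?B = "X \<inter> cball x \<rho>"
  have B: "z \<in> X" "dist z x < d" if "z \<in> ?B" for z
    using that \<rho> by (auto simp: dist_commute)
  have ex: "\<exists>h\<in>{-\<epsilon>..\<epsilon>}. f (\<phi> h z) = f x" if z: "z \<in> ?B" for z
  proof -
    have "f (\<phi> (-\<epsilon>) z) \<le> f x" "f x \<le> f (\<phi> \<epsilon> z)"
      using \<rho>12(3,4)[of z] z \<rho> \<open>f (\<phi> (-\<epsilon>) x) < f x\<close> \<open>f x < f (\<phi> \<epsilon> x)\<close>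
      by (cases "z = x"; force simp: dist_commute)+
    moreover have "continuous_on {-\<epsilon>..\<epsilon>} (\<lambda>h. f (\<phi> h z))"
      using B[OF z] by (intro continuous_on_compose2[OF contf] continuous_intros) auto
    ultimately show ?thesis
      using IVT'[of "\<lambda>h. f (\<phi> h z)" "-\<epsilon>" "f x" \<epsilon>] \<epsilon> by fastforce
  qed
  define \<sigma> where "\<sigma> z = (SOME h. h \<in> {-\<epsilon>..\<epsilon>} \<and> f (\<phi> h z) = f x)" for z
  have \<sigma>: "\<sigma> z \<in> {-\<epsilon>..\<epsilon>}" "f (\<phi> (\<sigma> z) z) = f x" if "z \<in> ?B" for z
    using someI_ex[of "\<lambda>h. h \<in> {-\<epsilon>..\<epsilon>} \<and> f (\<phi> h z) = f x"] ex[OF that]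
    unfolding \<sigma>_def by blast+
  have uniq: "h = \<sigma> z" if "z \<in> ?B" "h \<in> {-\<epsilon>..\<epsilon>}" "f (\<phi> h z) = f x" for z h
    using mono[of z h "\<sigma> z"] mono[of z "\<sigma> z" h] \<sigma>[OF that(1)] B[OF that(1)] that \<epsilon>
    by (cases h "\<sigma> z" rule: linorder_cases) auto
  have "continuous_on ?B \<sigma>"
  proof (rule continuous_from_closed_graph[of "{-\<epsilon>..\<epsilon>}"])
    have "(\<lambda>z. (z, \<sigma> z)) ` ?B = {p \<in> ?B \<times> {-\<epsilon>..\<epsilon>}. f (\<phi> (snd p) (fst p)) = f x}"
      using \<sigma> uniq by (auto simp: image_iff)
    moreover have "closed \<dots>"
      using compact_X
      by (intro continuous_closed_preimage_constant continuous_on_compose2[OF contf] continuous_intros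
          closed_Times closed_Int) (auto simp: compact_imp_closed)
    ultimately show "closed ((\<lambda>z. (z, \<sigma> z)) ` ?B)" by simp
  qed (use \<sigma> in auto)
  moreover have "\<phi> h (\<phi> (\<sigma> z) z) \<noteq> \<phi> (\<sigma> w) w"
    if "z \<in> ?B" "w \<in> ?B" "0 < h" "h \<le> \<epsilon>" for z w h
  proof -
    have "f (\<phi> (\<sigma> z) z) < f (\<phi> (\<sigma> z + h) z)"
      using that B[of z] \<sigma>(1)[of z] \<epsilon> by (intro mono) auto
    then show ?thesis
      using \<sigma>(2) that B[of z] by (metis flow_flow add.commute less_irrefl)
  qed
  moreover have "\<bar>\<sigma> z\<bar> \<le> \<epsilon>" if "z \<in> ?B" for z using \<sigma>(1)[OF that] by auto
  ultimately show ?thesis using that[of \<epsilon> \<rho> \<sigma>] \<epsilon> \<rho> by blast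
qed

text \<open>Otherwise the orbit of \<open>y\<close> comes near \<open>x\<close> at two distant
  times. The segment between these two points, slid along the flow onto the local section, closes up
  the orbit once it is cut at its first return.\<close>

lemma omega_limit_singular:
  assumes no_sing: "\<not> (\<exists>p\<in>interior X. singularity \<phi> p)"
    and y: "y \<in> X" and x: "x \<in> X"
    and t: "filterlim t at_top sequentially" "(\<lambda>n. \<phi> (t n) y) \<longlonglongrightarrow> x"
  shows "singularity \<phi> x"
proof (rule ccontr)
  assume "\<not> singularity \<phi> x"
  from local_section[OF x this] obtain \<epsilon> \<rho> :: real and \<sigma> where
      \<epsilon>\<rho>: "0 < \<epsilon>" "0 < \<rho>" and cont\<sigma>: "continuous_on (X \<inter> cball x \<rho>) \<sigma>"
      and \<sigma>: "\<And>z. z \<in> X \<inter> cball x \<rho> \<Longrightarrow> \<bar>\<sigma> z\<bar> \<le> \<epsilon>"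
      and free: "\<And>z w h. z \<in> X \<inter> cball x \<rho> \<Longrightarrow> w \<in> X \<inter> cball x \<rho> \<Longrightarrow> 0 < h \<Longrightarrow> h \<le> \<epsilon> \<Longrightarrow>
           \<phi> h (\<phi> (\<sigma> z) z) \<noteq> \<phi> (\<sigma> w) w" by blast
  let ?B = "X \<inter> cball x \<rho>"
  have ev: "\<forall>\<^sub>F n in sequentially. \<phi> (t n) y \<in> ?B"
    using tendstoD[OF t(2) \<epsilon>\<rho>(2)] y by (auto elim!: eventually_mono simp: dist_commute)
  then obtain n1 where n1: "\<phi> (t n1) y \<in> ?B"
    using eventually_happens' sequentially_bot by blast
  \<comment> \<open>Sliding onto the section shifts each of the two times by at most
    \<open>\<epsilon>\<close>, so \<open>a + \<epsilon> \<le> b\<close> remains.\<close>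
  have "\<forall>\<^sub>F n in sequentially. t n1 + 3 * \<epsilon> \<le> t n"
    using t(1) by (simp add: filterlim_at_top)
  then obtain n2 where n2: "\<phi> (t n2) y \<in> ?B" "t n1 + 3 * \<epsilon> \<le> t n2"
    using eventually_happens'[OF sequentially_bot eventually_conj[OF ev]] by blast
  define c where "c u = (\<lambda>z. \<phi> (\<sigma> z) z) (linepath (\<phi> (t n2) y) (\<phi> (t n1) y) u)" for u
  have convB: "convex ?B" using convex_X by (intro convex_Int) auto
  have line: "linepath (\<phi> (t n2) y) (\<phi> (t n1) y) u \<in> ?B" if "u \<in> {0..1}" for u
    using convex_contains_segment[of ?B] convB n1 n2 that linepath_in_path by blast
  have contc: "continuous_on {0..1} c"
    unfolding c_def using line
    by (intro continuous_intros continuous_on_compose2[OF cont\<sigma>]) auto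
  have cX: "c ` {0..1} \<subseteq> X" using line by (auto simp: c_def)
  have c_free: "\<phi> h (c u) \<notin> c ` {0..1}" if "0 < h" "h \<le> \<epsilon>" "u \<in> {0..1}" for h u
    using free[OF line line that(1,2)] that(3) unfolding c_def by fastforce
  define a where "a = t n1 + \<sigma> (\<phi> (t n1) y)"
  define b where "b = t n2 + \<sigma> (\<phi> (t n2) y)"
  have ab: "c 1 = \<phi> a y" "c 0 = \<phi> b y"
    using y by (auto simp: c_def linepath_def a_def b_def add.commute)
  have "a + \<epsilon> \<le> b"
    using \<sigma>[OF n1] \<sigma>[OF n2(1)] n2(2) unfolding a_def b_def by linarith
  \<comment> \<open>\<open>c_free\<close> excludes returns sooner than
    \<open>a + \<epsilon>\<close>, so the minimum \<open>b'\<close> of this compact set is the first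
    return after \<open>a\<close>.\<close>
  define R where "R = {r \<in> {a + \<epsilon>..b}. \<phi> r y \<in> c ` {0..1}}"
  have "compact R"
  proof -
    have "closed (c ` {0..1})"
      using contc by (intro compact_imp_closed compact_continuous_image compact_Icc)
    then have "closed R"
      unfolding R_def using y by (intro continuous_closed_preimage[unfolded vimage_def Int_def mem_Collect_eq] continuous_intros) auto
    then show ?thesis
      unfolding R_def by (metis (no_types, lifting) bounded_closed_interval bounded_subset compact_eq_bounded_closed mem_Collect_eq subsetI)
  qed
  moreover have "b \<in> R" using \<open>a + \<epsilon> \<le> b\<close> ab(2) by (auto simp: R_def image_iff intro!: bexI[of _ 0])
  ultimately obtain b' where b': "b' \<in> R" "\<And>r. r \<in> R \<Longrightarrow> b' \<le> r"
    using compact_attains_inf[of R] by auto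
  then obtain u0 where u0: "u0 \<in> {0..1}" "\<phi> b' y = c u0" by (auto simp: R_def)
  \<comment> \<open>Only the part of \<open>c\<close> from the point of first return to
    \<open>c 1\<close> closes up the arc.\<close>
  define c' where "c' u = c (u0 + (1 - u0) * u)" for u
  have rng: "u0 + (1 - u0) * u \<in> {0..1}" if "u \<in> {0..1}" for u
  proof -
    have "(1 - u0) * u \<le> 1 - u0" "0 \<le> (1 - u0) * u"
      using that u0 by (auto intro!: mult_left_le)
    then show ?thesis using u0 by auto
  qed
  then have sub: "c' ` {0..1} \<subseteq> c ` {0..1}" by (auto simp: c'_def)
  have "\<exists>p\<in>interior X. singularity \<phi> p"
  proof (rule singularity_of_closed_up_orbit)
    show "0 < b' - a" using b'(1) \<epsilon>\<rho>(1) by (auto simp: R_def)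
    show "continuous_on {0..1} c'"
      unfolding c'_def using rng by (intro continuous_on_compose2[OF contc] continuous_intros) auto
    show "c' 0 = \<phi> (b' - a) (c' 1)"
      using y u0 ab by (simp add: c'_def)
    show "\<phi> h (c' u) \<notin> c' ` {0..1}" if "0 < h" "h \<le> \<epsilon>" "u \<in> {0..1}" for h u
      using c_free[OF that(1,2) rng[OF that(3)]] sub by (auto simp: c'_def)
    show "\<phi> r (c' 1) \<notin> c' ` {0..1}" if r: "0 < r" "r < b' - a" for r
    proof (cases "r \<le> \<epsilon>")
      case True
      then show ?thesis using c_free[of r 1] r sub by (auto simp: c'_def)
    next
      case False
      have "r + a \<notin> R" using b'(2)[of "r + a"] r by auto
      moreover have "r + a \<in> {a + \<epsilon>..b}" using False r b'(1) by (auto simp: R_def)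
      ultimately show ?thesis using sub ab y by (auto simp: R_def c'_def)
    qed
  qed (use sub cX \<epsilon>\<rho> in auto)
  with no_sing show False by blast
qed

section \<open>Kinematic expansive flows\<close>

lemma reversed_flow: "planar_flow X (\<lambda>t. \<phi> (- t))"
proof unfold_locales
  show "continuous_flow_on X (\<lambda>t. \<phi> (- t))"
    unfolding continuous_flow_on_def case_prod_beta
    by (auto simp: algebra_simps intro!: continuous_intros)
qed (rule compact_X convex_X)+

text \<open>An orbit leaving the balls around \<open>Z\<close> at arbitrarily late times would have
  a limit point outside them, yet limit points are singular. Eventually it stays in the union of
  these balls; they are disjoint, so connectedness confines it to one.\<close>

lemma eventually_near_singularity:
  assumes no_sing: "\<not> (\<exists>p\<in>interior X. singularity \<phi> p)"
    and r: "0 < r" and sep: "\<And>p q. p \<in> Z \<Longrightarrow> q \<in> Z \<Longrightarrow> p \<noteq> q \<Longrightarrow> 2 * r < dist p q"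
    and Z: "Z = {p \<in> X. singularity \<phi> p}"
    and y: "y \<in> X"
  shows "\<exists>p\<in>Z. \<exists>n::nat. \<forall>t\<ge>real n. \<phi> t y \<in> cball p r"
proof -
  have "\<exists>n::nat. \<forall>t\<ge>real n. \<phi> t y \<in> (\<Union>p\<in>Z. ball p r)"
  proof (rule ccontr)
    assume "\<not> ?thesis"
    then obtain t where t: "\<And>n::nat. real n \<le> t n" "\<And>n. \<phi> (t n) y \<notin> (\<Union>p\<in>Z. ball p r)" by metis
    have "\<phi> (t n) y \<in> X - (\<Union>p\<in>Z. ball p r)" for n using t(2) y by auto
    moreover have "compact (X - (\<Union>p\<in>Z. ball p r))"
      using compact_X by (intro compact_diff) auto
    ultimately obtain x k where x: "x \<in> X - (\<Union>p\<in>Z. ball p r)" "strict_mono k"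
        "((\<lambda>n. \<phi> (t n) y) \<circ> k) \<longlonglongrightarrow> x"
      unfolding compact_def by metis
    have "filterlim t at_top sequentially"
      using t(1) by (intro filterlim_at_top_mono[OF filterlim_real_sequentially]) auto
    from filterlim_compose[OF this filterlim_subseq[OF x(2)]]
    have "filterlim (\<lambda>n. t (k n)) at_top sequentially" .
    then have "singularity \<phi> x"
      using x y no_sing by (intro omega_limit_singular[of y x "\<lambda>n. t (k n)"]) (auto simp: o_def)
    then show False using x(1) r Z by auto
  qed
  then obtain n :: nat where n: "\<And>t. real n \<le> t \<Longrightarrow> \<phi> t y \<in> (\<Union>p\<in>Z. ball p r)" by blast
  then obtain p where p: "p \<in> Z" "\<phi> (real n) y \<in> ball p r" by blast
  let ?O = "(\<lambda>t. \<phi> t y) ` {real n..}" and ?V = "\<Union>q\<in>Z-{p}. ball q r"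
  have conn: "connected ?O"
    using y by (intro connected_continuous_image continuous_intros) auto
  have disj: "ball p r \<inter> ?V \<inter> ?O = {}"
  proof -
    have "dist p q < 2 * r" if "z \<in> ball p r" "z \<in> ball q r" for z q
      using that dist_triangle2[of p q z] by (simp add: dist_commute)
    then show ?thesis using sep[OF p(1)] by force
  qed
  have "?O \<subseteq> ball p r \<union> ?V" using n by blast
  then have "?V \<inter> ?O = {}"
    using connectedD[OF conn _ _ disj] p(2) by blast
  then have "\<forall>t\<ge>real n. \<phi> t y \<in> cball p r"
    using \<open>?O \<subseteq> ball p r \<union> ?V\<close> ball_subset_cball by blast
  with p(1) show ?thesis by blast
qed

text \<open>A periodic point is a limit point of its own orbit, along the multiples of its period,
  and so would be singular.\<close>

lemma orbit_inj:
  assumes no_sing: "\<not> (\<exists>p\<in>interior X. singularity \<phi> p)"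
    and x: "x \<in> X" "\<not> singularity \<phi> x"
  shows "inj (\<lambda>t. \<phi> t x)"
proof (rule linorder_injI, rule notI)
  fix s t :: real assume "s < t" "\<phi> s x = \<phi> t x"
  then have "\<phi> (-s) (\<phi> s x) = \<phi> (-s) (\<phi> t x)" by simp
  then have "\<phi> (t - s) x = x" using x(1) by simp
  then have "\<phi> (real n * (t - s)) x = x" for n
    using flow_of_int_period[OF x(1), of "t - s" "int n"] by simp
  moreover have "filterlim (\<lambda>n. real n * (t - s)) at_top sequentially"
    using \<open>s < t\<close> by (intro filterlim_at_top_mult_tendsto_pos[OF tendsto_const _ filterlim_real_sequentially]) simp
  ultimately have "singularity \<phi> x"
    using omega_limit_singular[OF no_sing x(1) x(1)] by simp
  with x(2) show False ..
qed

text \<open>A punctured disc is connected, a punctured interval is not: the inverse \<open>h\<close>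
  of the arc would map \<open>ball x r - {x}\<close> onto a connected set that contains
  \<open>- s\<close> and \<open>s\<close> but not 0.\<close>

lemma orbit_arc_empty_interior:
  assumes no_sing: "\<not> (\<exists>p\<in>interior X. singularity \<phi> p)"
    and x: "x \<in> X" "\<not> singularity \<phi> x" and r: "0 < r"
  shows "\<not> ball x r \<subseteq> (\<lambda>t. \<phi> t x) ` {-1..1}"
proof
  let ?g = "\<lambda>t. \<phi> t x"
  assume sub: "ball x r \<subseteq> ?g ` {-1..1}"
  have inj: "inj ?g" by (rule orbit_inj[OF no_sing x])
  have cont: "continuous_on A ?g" for A using x(1) by (intro continuous_intros) auto
  have "\<exists>h. homeomorphism {-1..1} (?g ` {-1..1}) ?g h"
    using inj by (intro homeomorphism_compact cont refl compact_Icc) (auto simp: inj_on_def)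
  then obtain h where "homeomorphism {-1..1} (?g ` {-1..1}) ?g h" by blast
  then have h: "continuous_on (?g ` {-1..1}) h" "\<And>t. t \<in> {-1..1} \<Longrightarrow> h (?g t) = t"
    by (simp_all add: homeomorphism_def)
  have "isCont ?g 0" using cont[of UNIV] by (simp add: continuous_on_eq_continuous_at)
  then obtain d where d: "0 < d" "\<And>t. \<bar>t\<bar> < d \<Longrightarrow> dist (?g t) x < r"
    unfolding continuous_at_eps_delta using r x(1) by (force simp: dist_real_def)
  define s where "s = min (d/2) 1"
  have s: "0 < s" "s < d" "s \<le> 1" using d(1) by (auto simp: s_def)
  let ?S = "h ` (ball x r - {x})"
  have "connected ?S"
    using sub by (intro connected_continuous_image continuous_on_subset[OF h(1)] connected_punctured_ball) auto
  moreover have "t \<in> ?S" if "\<bar>t\<bar> = s" for t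
  proof -
    have "?g t \<noteq> ?g 0" using inj that s(1) by (auto simp: inj_def)
    then have "?g t \<in> ball x r - {x}" using d(2)[of t] that s x(1) by (simp add: dist_commute)
    moreover have "h (?g t) = t" using that s by (intro h(2)) auto
    ultimately show ?thesis by (metis imageI)
  qed
  then have "- s \<in> ?S" "s \<in> ?S" using s(1) by auto
  ultimately have "0 \<in> ?S"
    using s(1) connectedD_interval[of ?S "-s" s 0] by simp
  then obtain z where "0 = h z" "z \<in> ball x r - {x}" by (rule imageE)
  then have z: "z \<in> ball x r" "z \<noteq> x" "h z = 0" by auto
  then obtain t where t: "t \<in> {-1..1}" "z = ?g t" using sub by blast
  then have "t = 0" using h(2) z(3) by metis
  then show False using t z(2) x(1) by simp
qed

theorem kinematic_expansive_imp_interior_singularity: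
  assumes exp: "kinematic_expansive_on X \<phi>" and int: "interior X \<noteq> {}"
  shows "\<exists>p\<in>interior X. singularity \<phi> p"
proof (rule ccontr)
  assume no_sing: "\<not> ?thesis"
  have "(0::real) < 1" by simp
  then obtain \<delta> where \<delta>: "0 < \<delta>" "\<And>x y. x \<in> X \<Longrightarrow> y \<in> X \<Longrightarrow> (\<And>t. dist (\<phi> t x) (\<phi> t y) < \<delta>) \<Longrightarrow>
      \<exists>s. \<bar>s\<bar> < 1 \<and> y = \<phi> s x"
    using exp unfolding kinematic_expansive_on_def by meson
  define Z where "Z = {p \<in> X. singularity \<phi> p}"
  \<comment> \<open>Points in a common ball of radius \<open>r\<close> are less than
    \<open>\<delta>\<close> apart, and balls around distinct singularities are disjoint.\<close>
  define r where "r = \<delta> / 4"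
  have r: "0 < r" "2 * r < \<delta>" using \<delta>(1) by (auto simp: r_def)
  \<comment> \<open>Singularities do not move, so closer ones would share an orbit and
    coincide.\<close>
  have sep: "\<delta> \<le> dist p q" if "p \<in> Z" "q \<in> Z" "p \<noteq> q" for p q
    using \<delta>(2)[of p q] that by (force simp: Z_def singularity_def)
  have "finite Z"
  proof (rule ccontr)
    assume "infinite Z"
    then obtain l where l: "l islimpt Z"
      using compact_X Heine_Borel_imp_Bolzano_Weierstrass[of X Z] by (auto simp: Z_def)
    then obtain p where p: "p \<in> Z" "p \<noteq> l" "dist p l < \<delta>/2"
      using \<delta>(1) unfolding islimpt_approachable by (meson half_gt_zero)
    \<comment> \<open>Taking \<open>q\<close> nearer to \<open>l\<close> than \<open>p\<close> makes
      the two distinct while both lie within \<open>\<delta>/2\<close> of \<open>l\<close>.\<close>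
    moreover have "0 < min (\<delta>/2) (dist p l)" using p \<delta>(1) by simp
    ultimately obtain q where q: "q \<in> Z" "q \<noteq> l" "dist q l < min (\<delta>/2) (dist p l)"
      using l unfolding islimpt_approachable by meson
    then have "p \<noteq> q" by auto
    then show False
      using sep[of p q] p q dist_triangle2[of p q l] by simp
  qed
  define A where "A = (\<lambda>(p, q, n::nat). {x \<in> X. \<forall>t\<ge>real n. \<phi> t x \<in> cball p r \<and> \<phi> (-t) x \<in> cball q r})"
  let ?I = "Z \<times> Z \<times> (UNIV :: nat set)"
  have closedA: "closed (A i)" for i
  proof -
    obtain p q n where i: "i = (p, q, n)" by (cases i) auto
    have "A i = X \<inter> (\<Inter>t\<in>{real n..}. {x \<in> X. \<phi> t x \<in> cball p r} \<inter> {x \<in> X. \<phi> (-t) x \<in> cball q r})"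
      unfolding i A_def by auto
    moreover have "closed {x \<in> X. \<phi> t x \<in> cball p r}" for t p
    proof -
      have "closed (X \<inter> (\<lambda>x. \<phi> t x) -` cball p r)"
        using compact_X by (intro continuous_closed_preimage continuous_intros) (auto simp: compact_imp_closed)
      then show ?thesis by (simp add: vimage_def Int_def)
    qed
    ultimately show ?thesis
      using compact_imp_closed[OF compact_X] by (simp add: closed_INT closed_Int)
  qed
  have cover: "\<exists>i\<in>?I. x \<in> A i" if x: "x \<in> X" for x
  proof -
    have sep': "2 * r < dist p q" if "p \<in> Z" "q \<in> Z" "p \<noteq> q" for p q
      using sep[OF that] r by linarith
    obtain p n where p: "p \<in> Z" "\<forall>t\<ge>real n. \<phi> t x \<in> cball p r"
      using eventually_near_singularity[OF no_sing r(1) sep' Z_def x] by blast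
    \<comment> \<open>The backward orbit is handled as a forward orbit of the reversed flow, which
      has the same singularities.\<close>
    have sing_rev: "singularity (\<lambda>t. \<phi> (-t)) p \<longleftrightarrow> singularity \<phi> p" for p
      unfolding singularity_def by (metis minus_minus)
    then have rev: "\<not> (\<exists>p\<in>interior X. singularity (\<lambda>t. \<phi> (-t)) p)"
        "Z = {p \<in> X. singularity (\<lambda>t. \<phi> (-t)) p}"
      using no_sing by (simp_all add: Z_def)
    obtain q m where q: "q \<in> Z" "\<forall>t\<ge>real m. \<phi> (-t) x \<in> cball q r"
      using planar_flow.eventually_near_singularity[OF reversed_flow rev(1) r(1) sep' rev(2) x] by blast
    have "x \<in> A (p, q, max n m)" using p q x by (auto simp: A_def)
    with p q show ?thesis by blast
  qed
  \<comment> \<open>Otherwise countably many relatively open dense sets \<open>X - A i\<close> would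
    have a dense intersection, but by \<open>cover\<close> it is empty.\<close>
  have "\<exists>i\<in>?I. \<not> X \<subseteq> closure (X - A i)"
  proof (rule ccontr)
    assume "\<not> ?thesis"
    then have dense: "X \<subseteq> closure (X - A i)" if "i \<in> ?I" for i using that by blast
    have "X \<subseteq> closure (\<Inter>((\<lambda>i. X - A i) ` ?I))"
    proof (rule Baire)
      show "countable ((\<lambda>i. X - A i) ` ?I)"
        using \<open>finite Z\<close> by (intro countable_image countable_SIGMA) (auto intro: countable_finite)
      show "openin (top_of_set X) T \<and> X \<subseteq> closure T" if "T \<in> (\<lambda>i. X - A i) ` ?I" for T
        using that dense closedA by (auto simp: Diff_eq intro!: openin_open_Int)
    qed (use compact_X compact_imp_closed in auto)
    moreover have "X \<noteq> {}" using int interior_subset by blast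
    moreover have "\<Inter>((\<lambda>i. X - A i) ` ?I) = {}"
      using cover \<open>X \<noteq> {}\<close> by blast
    ultimately show False by simp
  qed
  then obtain p q n x where x: "x \<in> X" "x \<notin> closure (X - A (p, q, n))" by blast
  then obtain e where "0 < e" "\<And>z. z \<in> X - A (p, q, n) \<Longrightarrow> \<not> dist z x < e"
    unfolding closure_approachable by blast
  then have e: "0 < e" "\<And>z. z \<in> X \<Longrightarrow> dist z x < e \<Longrightarrow> z \<in> A (p, q, n)" by blast+
  \<comment> \<open>\<open>x\<close> may lie on the boundary, so the argument moves to a nearby
    interior point \<open>w\<close>, which is not singular.\<close>
  have "x \<in> closure (interior X)"
    using x(1) convex_closure_interior[OF convex_X int] closure_subset by blast
  then obtain w where w: "w \<in> interior X" "dist w x < e"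
    using e(1) unfolding closure_approachable by blast
  then have wX: "w \<in> X" using interior_subset by blast
  have "open (interior X \<inter> ball x e)" by (intro open_Int open_interior open_ball)
  moreover have "w \<in> interior X \<inter> ball x e" using w by (simp add: dist_commute)
  ultimately obtain \<rho> where \<rho>: "0 < \<rho>" "ball w \<rho> \<subseteq> interior X \<inter> ball x e"
    unfolding open_contains_ball by blast
  have ballA: "z \<in> X" "z \<in> A (p, q, n)" if "z \<in> ball w \<rho>" for z
  proof -
    have z: "z \<in> interior X" "z \<in> ball x e" using that \<rho>(2) by blast+
    then show "z \<in> X" using interior_subset by blast
    then show "z \<in> A (p, q, n)" using e(2)[of z] z(2) by (simp add: dist_commute)
  qed
  \<comment> \<open>This keeps nearby orbits together on the bounded time interval; at later and
    earlier times membership in \<open>A (p, q, n)\<close> does.\<close>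
  have "uniformly_continuous_on ({-real n..real n} \<times> X) (\<lambda>(t, x). \<phi> t x)"
    unfolding case_prod_beta using compact_X
    by (intro compact_uniformly_continuous continuous_intros compact_Times) auto
  then obtain \<eta> where \<eta>: "0 < \<eta>" "\<And>u v. u \<in> {-real n..real n} \<times> X \<Longrightarrow> v \<in> {-real n..real n} \<times> X \<Longrightarrow>
      dist v u < \<eta> \<Longrightarrow> dist ((\<lambda>(t, x). \<phi> t x) v) ((\<lambda>(t, x). \<phi> t x) u) < \<delta>"
    unfolding uniformly_continuous_on_def using \<delta>(1) by blast
  have "ball w (min \<rho> \<eta>) \<subseteq> (\<lambda>t. \<phi> t w) ` {-1..1}"
  proof
    fix z assume z: "z \<in> ball w (min \<rho> \<eta>)"
    have "dist (\<phi> t w) (\<phi> t z) < \<delta>" for t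
    proof -
      have near: "dist a b < \<delta>" if "a \<in> cball c r" "b \<in> cball c r" for a b c
        using that r dist_triangle3[of a b c] by simp
      have A: "w \<in> A (p, q, n)" "z \<in> A (p, q, n)" "z \<in> X" using z ballA \<rho>(1) by auto
      consider "t \<in> {-real n..real n}" | "real n \<le> t" | "real n \<le> - t" by force
      then show ?thesis
      proof cases
        case 1
        then show ?thesis
          using \<eta>(2)[of "(t, z)" "(t, w)"] z A(3) wX by (simp add: dist_Pair_Pair)
      next
        case 2
        then show ?thesis using A by (intro near[of _ p]) (auto simp: A_def)
      next
        case 3
        then have "\<phi> (- (- t)) w \<in> cball q r" "\<phi> (- (- t)) z \<in> cball q r"
          using A unfolding A_def by blast+
        then show ?thesis using near[of _ q] by simp
      qed
    qed
    moreover have "z \<in> X" using z ballA by simp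
    ultimately obtain s where "\<bar>s\<bar> < 1" "z = \<phi> s w" using \<delta>(2)[OF wX] by blast
    then show "z \<in> (\<lambda>t. \<phi> t w) ` {-1..1}" by (intro image_eqI[of _ _ s]) auto
  qed
  moreover have "\<not> singularity \<phi> w" using w no_sing by blast
  ultimately show False
    using orbit_arc_empty_interior[OF no_sing wX] \<rho>(1) \<eta>(1) by simp
qed

end

section \<open>Transfer to an abstract disc by conjugation\<close>

lemma continuous_flow_on_conjugate:
  assumes "homeomorphism D X f g" "continuous_flow_on D \<phi>"
  shows "continuous_flow_on X (\<lambda>t x. f (\<phi> t (g x)))"
proof -
  interpret flow_on D \<phi> by unfold_locales (rule assms)
  have fg: "continuous_on D f" "continuous_on X g" "\<And>x. x \<in> D \<Longrightarrow> g (f x) = x" "\<And>x. x \<in> X \<Longrightarrow> f (g x) = x"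
      "\<And>x. x \<in> D \<Longrightarrow> f x \<in> X" "\<And>x. x \<in> X \<Longrightarrow> g x \<in> D"
    using assms(1) unfolding homeomorphism_def by blast+
  have "continuous_on (UNIV \<times> X) (\<lambda>(t, x). f (\<phi> t (g x)))"
    unfolding case_prod_beta using fg
    by (intro continuous_on_compose2[OF fg(1)] continuous_on_compose2[OF fg(2)] continuous_intros) auto
  then show ?thesis
    unfolding continuous_flow_on_def using fg by simp
qed

text \<open>Uniform continuity of \<open>g\<close> on the compact \<open>X\<close> turns closeness
  of conjugate orbits into closeness in \<open>D\<close>; the time shift \<open>s\<close> is
  unchanged by conjugation.\<close>

lemma kinematic_expansive_on_conjugate:
  assumes h: "homeomorphism D X f g" and X: "compact X"
    and flow: "continuous_flow_on D \<phi>" and exp: "kinematic_expansive_on D \<phi>"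
  shows "kinematic_expansive_on X (\<lambda>t x. f (\<phi> t (g x)))"
  unfolding kinematic_expansive_on_def
proof (intro allI impI)
  interpret flow_on D \<phi> by unfold_locales (rule flow)
  have fg: "continuous_on X g" "\<And>x. x \<in> D \<Longrightarrow> g (f x) = x" "\<And>x. x \<in> X \<Longrightarrow> f (g x) = x"
      "\<And>x. x \<in> D \<Longrightarrow> f x \<in> X" "\<And>x. x \<in> X \<Longrightarrow> g x \<in> D"
    using h unfolding homeomorphism_def by blast+
  fix \<epsilon> :: real assume "0 < \<epsilon>"
  then obtain \<delta> where \<delta>: "0 < \<delta>" "\<And>x y. x \<in> D \<Longrightarrow> y \<in> D \<Longrightarrow> \<forall>t. dist (\<phi> t x) (\<phi> t y) < \<delta> \<Longrightarrow>
      \<exists>s. \<bar>s\<bar> < \<epsilon> \<and> y = \<phi> s x"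
    using exp unfolding kinematic_expansive_on_def by meson
  obtain \<eta> where \<eta>: "0 < \<eta>" "\<And>x y. x \<in> X \<Longrightarrow> y \<in> X \<Longrightarrow> dist y x < \<eta> \<Longrightarrow> dist (g y) (g x) < \<delta>"
    using compact_uniformly_continuous[OF fg(1) X] \<delta>(1) unfolding uniformly_continuous_on_def by meson
  show "\<exists>\<eta>>0. \<forall>x\<in>X. \<forall>y\<in>X. (\<forall>t. dist (f (\<phi> t (g x))) (f (\<phi> t (g y))) < \<eta>) \<longrightarrow>
      (\<exists>s. \<bar>s\<bar> < \<epsilon> \<and> y = f (\<phi> s (g x)))"
  proof (rule exI[of _ \<eta>], intro conjI ballI impI \<eta>(1))
    fix x y assume xy: "x \<in> X" "y \<in> X" and near: "\<forall>t. dist (f (\<phi> t (g x))) (f (\<phi> t (g y))) < \<eta>"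
    have "dist (\<phi> t (g x)) (\<phi> t (g y)) < \<delta>" for t
      using \<eta>(2)[of "f (\<phi> t (g y))" "f (\<phi> t (g x))"] near xy fg by simp
    then obtain s where "\<bar>s\<bar> < \<epsilon>" "g y = \<phi> s (g x)"
      using \<delta>(2)[of "g x" "g y"] xy fg by blast
    then show "\<exists>s. \<bar>s\<bar> < \<epsilon> \<and> y = f (\<phi> s (g x))" using xy fg by metis
  qed
qed

theorem proposition5p1:
  fixes D :: "'a::metric_space set" and \<phi> :: "real \<Rightarrow> 'a \<Rightarrow> 'a"
  assumes "compact_disc D"
    and "continuous_flow_on D \<phi>"
    and "kinematic_expansive_on D \<phi>"
  shows "\<exists>p \<in> surface_interior D. singularity \<phi> p"
proof -
  have "(cball 0 1 :: (real^2) set) homeomorphic (cball 0 1 :: complex set)"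
    by (rule homeomorphic_convex_compact_sets) (auto simp: aff_dim_cball)
  then have "D homeomorphic (cball 0 1 :: complex set)"
    using assms(1) homeomorphic_trans unfolding compact_disc_def by blast
  then obtain f g where h: "homeomorphism D (cball 0 1 :: complex set) f g"
    unfolding homeomorphic_def by blast
  have fg: "\<And>x. x \<in> D \<Longrightarrow> g (f x) = x" "\<And>x. x \<in> cball 0 1 \<Longrightarrow> g x \<in> D"
    using h unfolding homeomorphism_def by blast+
  interpret flow_on D \<phi> by unfold_locales (rule assms)
  interpret disc: planar_flow "cball 0 1" "\<lambda>t x. f (\<phi> t (g x))"
    by unfold_locales (auto intro: continuous_flow_on_conjugate[OF h assms(2)])
  have "\<exists>p\<in>interior (cball 0 1). singularity (\<lambda>t x. f (\<phi> t (g x))) p"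
    using kinematic_expansive_on_conjugate[OF h _ assms(2,3)]
    by (intro disc.kinematic_expansive_imp_interior_singularity) auto
  then obtain p where p: "p \<in> ball 0 1" "\<And>t. f (\<phi> t (g p)) = p"
    unfolding singularity_def by auto
  have gp: "g p \<in> D" using p(1) fg(2)[of p] by simp
  have "\<phi> t (g p) = g p" for t
    using fg(1)[of "\<phi> t (g p)"] p(2)[of t] gp by simp
  then have "singularity \<phi> (g p)" by (simp add: singularity_def)
  moreover have "g p \<in> surface_interior D"
  proof -
    have h': "homeomorphism (cball 0 1) D g f" using h by (rule homeomorphism_symD)
    \<comment> \<open>The image of the open disc is the neighbourhood that witnesses
      \<open>g p\<close> as a point of the surface interior.\<close>
    have "openin (top_of_set D) (g ` ball 0 1)"
      by (rule homeomorphism_imp_open_map[OF h']) (auto intro: open_subset)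
    moreover have "homeomorphism (ball 0 1) (g ` ball 0 1) g f"
      by (rule homeomorphism_of_subsets[OF h' _ order_refl refl]) auto
    then have "g ` ball 0 1 homeomorphic (ball 0 1 :: complex set)"
      using homeomorphic_sym unfolding homeomorphic_def by blast
    moreover have "(ball 0 1 :: complex set) homeomorphic (ball 0 1 :: (real^2) set)"
    proof (rule homeomorphic_trans[OF homeomorphic_ball01_UNIV])
      have "(UNIV :: complex set) homeomorphic (UNIV :: (real^2) set)"
        by (simp add: homeomorphic_UNIV_UNIV)
      then show "(UNIV :: complex set) homeomorphic (ball 0 1 :: (real^2) set)"
        using homeomorphic_ball01_UNIV homeomorphic_sym homeomorphic_trans by blast
    qed
    ultimately show ?thesis
      using gp p(1) homeomorphic_trans unfolding surface_interior_def by blast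
  qed
  ultimately show ?thesis by blast
qed

end
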